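(* Let $X$ and $Y$ be Banach spaces. If $\mathcal B(X,Y)$ has the BCP, then both $X^*$ and $Y$ have the BCP.
   Context: $\mathcal B(X,Y)$ is the space of all bounded linear operators from $X$ into $Y$ with the operator norm, and $X^*$ is the dual space of $X$ with the dual norm. A normed space has the ball-covering property (BCP) if its unit sphere (the set of vectors of norm one) can be covered by countably many closed, or equivalently open, balls, none of which contains the origin.
   Formalization: X and Y are assumed nonzero: if X = {0}, then B(X,Y) = {0} has an empty unit sphere and so has the BCP vacuously, while Y (e.g. an uncountable-dimensional Hilbert space) may fail it; the case Y = {0} is symmetric. *)

theory Defs
  imports "HOL-Analysis.Analysis"
begin

text \<open>
  The libraries only provide real Banach spaces (class \<^class>\<open>banach\<close>). A complex Banach space is
  a real one with a compatible complex scalar multiplication that is absolutely homogeneous for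
  the given norm; the unit law follows from \<open>scaleR_scaleC\<close>.
\<close>

class complex_banach = banach +
  fixes scaleC :: "complex \<Rightarrow> 'a \<Rightarrow> 'a" (infixr "*\<^sub>C" 75)
  assumes scaleC_add_right: "z *\<^sub>C (x + y) = z *\<^sub>C x + z *\<^sub>C y"
    and scaleC_add_left: "(z + w) *\<^sub>C x = z *\<^sub>C x + w *\<^sub>C x"
    and scaleC_scaleC: "z *\<^sub>C w *\<^sub>C x = (z * w) *\<^sub>C x"
    and scaleR_scaleC: "r *\<^sub>R x = complex_of_real r *\<^sub>C x"
    and norm_scaleC: "norm (z *\<^sub>C x) = cmod z * norm x"

instantiation complex :: complex_banach
begin

definition scaleC_complex :: "complex \<Rightarrow> complex \<Rightarrow> complex"
  where "scaleC_complex z w = z * w"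

instance
  by standard (simp_all add: scaleC_complex_def algebra_simps norm_mult scaleR_conv_of_real)

end

text \<open>
  Bounded complex-linear operators, as a subspace of the bounded real-linear ones; the operator
  norm is the one of the ambient space. With \<open>'b = complex\<close> this is the complex dual of \<open>'a\<close>.
\<close>

definition bounded_clinear_ops :: "('a::complex_banach \<Rightarrow>\<^sub>L 'b::complex_banach) set"
  where "bounded_clinear_ops = {T. \<forall>z x. blinfun_apply T (z *\<^sub>C x) = z *\<^sub>C blinfun_apply T x}"

text \<open>
  The ball-covering property of a linear subspace \<open>V\<close>, regarded as a normed space in its own
  right (so the centres lie in \<open>V\<close>); a whole space is the case \<open>V = UNIV\<close>. A pair \<open>(c, r)\<close>
  encodes the closed ball with centre \<open>c\<close> and radius \<open>r\<close>. Finite families are allowed.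
\<close>

definition has_BCP :: "'a::real_normed_vector set \<Rightarrow> bool"
  where "has_BCP V \<longleftrightarrow>
    (\<exists>B. countable B \<and> B \<subseteq> V \<times> {0<..} \<and>
      (\<forall>(c, r)\<in>B. 0 \<notin> cball c r) \<and>
      V \<inter> sphere 0 1 \<subseteq> (\<Union>(c, r)\<in>B. cball c r))"

end

theory Submission
  imports Defs
begin

text \<open>
  Let \<open>c\<close> and \<open>r\<close> be the centre and radius of a ball of operators missing the origin, and pick \<open>x\<close>
  with \<open>r * norm x < norm (c x)\<close>. If the rank-one operator \<open>f \<otimes> y\<close> lies in the ball, then
  \<open>norm (f x * y - c x) \<le> r * norm x < norm (c x)\<close>. Fixing a norm-one functional \<open>f\<close>, this forces
  \<open>f x \<noteq> 0\<close> and puts \<open>y\<close> in a ball around \<open>c x / f x\<close> missing the origin. Fixing instead a unit vector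
  \<open>y\<close> and a functional \<open>g\<close> norming \<open>c x\<close>, it puts \<open>f\<close> in a ball around \<open>g \<circ> c / g y\<close> missing the
  origin. The norming functionals exist because, by Zorn's lemma, a sublinear functional dominates a
  minimal one, and a minimal sublinear functional is linear.
\<close>

section \<open>Norming functionals\<close>

text \<open>Homogeneity is required only as an inequality, which infima inherit easily; equality is
  recovered in \<open>sublinear_scaleR\<close> by scaling back with
  \<open>inverse c\<close>.\<close>

definition sublinear :: "('a::real_vector \<Rightarrow> real) \<Rightarrow> bool"
  where "sublinear q \<longleftrightarrow>
    (\<forall>x y. q (x + y) \<le> q x + q y) \<and> (\<forall>c x. c \<ge> 0 \<longrightarrow> q (c *\<^sub>R x) \<le> c * q x)"

lemma sublinear_add: "sublinear q \<Longrightarrow> q (x + y) \<le> q x + q y"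
  by (simp add: sublinear_def)

lemma sublinear_zero:
  assumes "sublinear q"
  shows "q 0 = 0"
proof -
  have "q (0 *\<^sub>R 0) \<le> 0 * q 0"
    using assms unfolding sublinear_def by blast
  moreover have "q (0 + 0) \<le> q 0 + q 0"
    using assms unfolding sublinear_def by blast
  ultimately show ?thesis by simp
qed

lemma sublinear_scaleR:
  assumes "sublinear q" "c \<ge> 0"
  shows "q (c *\<^sub>R x) = c * q x"
proof (cases "c = 0")
  case True
  then show ?thesis using sublinear_zero[OF assms(1)] by simp
next
  case False
  with assms have c: "c > 0" by simp
  have "q (inverse c *\<^sub>R c *\<^sub>R x) \<le> inverse c * q (c *\<^sub>R x)"
    using assms c unfolding sublinear_def by (meson inverse_nonnegative_iff_nonnegative)
  then have "c * q x \<le> q (c *\<^sub>R x)"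
    using c by (simp add: field_simps)
  moreover have "q (c *\<^sub>R x) \<le> c * q x"
    using assms unfolding sublinear_def by blast
  ultimately show ?thesis by simp
qed

lemma sublinear_minus_ge: "sublinear q \<Longrightarrow> - q (- x) \<le> q x"
  using sublinear_add[of q x "- x"] sublinear_zero[of q] by simp

text \<open>The witness is the infimum of \<open>q (x + t a) - t * q a\<close> over
  \<open>t \<ge> 0\<close>; the values \<open>t = 0\<close> and \<open>t = 1\<close> give the two
  bounds. Applied to a minimal functional it yields additivity, applied to the norm it singles out
  the direction \<open>a\<close>.\<close>

lemma sublinear_shift:
  fixes q :: "'a::real_vector \<Rightarrow> real"
  assumes q: "sublinear q"
  obtains q' where "sublinear q'" "\<And>x. q' x \<le> q x" "\<And>x. q' x \<le> q (x + a) - q a"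
proof -
  define h where "h = (\<lambda>x t. q (x + t *\<^sub>R a) - t * q a)"
  define q' where "q' = (\<lambda>x. INF t\<in>{0..}. h x t)"
  \<comment> \<open>The bound does not depend on \<open>t\<close>, so the infimum is finite.\<close>
  have low: "- q (- x) \<le> h x t" if "t \<ge> 0" for x t
    using sublinear_add[OF q, of "x + t *\<^sub>R a" "- x"] sublinear_scaleR[OF q that, of a]
    by (simp add: h_def)
  have bdd: "bdd_below (h x ` {0..})" for x
    using low by (intro bdd_belowI[of _ "- q (- x)"]) auto
  have le: "q' x \<le> h x t" if "t \<ge> 0" for x t
    unfolding q'_def using that by (intro cINF_lower bdd) auto
  have ge: "m \<le> q' x" if "\<And>t. t \<ge> 0 \<Longrightarrow> m \<le> h x t" for m x
    unfolding q'_def using that by (intro cINF_greatest) auto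
  have "q' (x + y) \<le> q' x + q' y" for x y
  proof -
    have "q' (x + y) \<le> h x s + h y t" if "s \<ge> 0" "t \<ge> 0" for s t
    proof -
      have "q' (x + y) \<le> h (x + y) (s + t)"
        using that by (intro le) simp
      also have "\<dots> \<le> h x s + h y t"
        using sublinear_add[OF q, of "x + s *\<^sub>R a" "y + t *\<^sub>R a"]
        by (simp add: h_def algebra_simps)
      finally show ?thesis .
    qed
    \<comment> \<open>The infimum is taken first over \<open>s\<close>, then over
      \<open>t\<close>.\<close>
    then have "q' (x + y) - h y t \<le> q' x" if "t \<ge> 0" for t
      using that by (intro ge) (simp add: algebra_simps)
    then have "q' (x + y) - q' x \<le> q' y"
      by (intro ge) (simp add: algebra_simps)
    then show ?thesis by simp
  qed
  moreover have "q' (c *\<^sub>R x) \<le> c * q' x" if "c \<ge> 0" for c x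
  proof (cases "c = 0")
    case True
    have "q' 0 \<le> h 0 0" by (rule le) simp
    then show ?thesis using True sublinear_zero[OF q] by (simp add: h_def)
  next
    case False
    with that have c: "c > 0" by simp
    have "q' (c *\<^sub>R x) / c \<le> h x t" if "t \<ge> 0" for t
    proof -
      \<comment> \<open>Rescaling the parameter along with the vector lets the factor
        \<open>c\<close> be pulled out of \<open>h\<close>.\<close>
      have "q' (c *\<^sub>R x) \<le> h (c *\<^sub>R x) (c * t)"
        using that c by (intro le) simp
      also have "\<dots> = c * h x t"
        using sublinear_scaleR[OF q, of c "x + t *\<^sub>R a"] c
        by (simp add: h_def algebra_simps)
      finally show ?thesis using c by (simp add: field_simps)
    qed
    then have "q' (c *\<^sub>R x) / c \<le> q' x" by (rule ge)
    then show ?thesis using c by (simp add: field_simps)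
  qed
  ultimately have "sublinear q'" by (simp add: sublinear_def)
  moreover have "q' x \<le> q x" for x
    using le[of 0 x] by (simp add: h_def)
  moreover have "q' x \<le> q (x + a) - q a" for x
    using le[of 1 x] by (simp add: h_def)
  ultimately show ?thesis using that by blast
qed

text \<open>Zorn's lemma for the reversed pointwise order. A nonempty chain is bounded by its
  pointwise infimum, which is finite because every member \<open>q\<close> satisfies
  \<open>- p (- x) \<le> - q (- x) \<le> q x\<close>.\<close>

lemma exists_minimal_sublinear:
  fixes p :: "'a::real_vector \<Rightarrow> real"
  assumes p: "sublinear p"
  obtains q where "sublinear q" "\<And>x. q x \<le> p x"
    "\<And>q'. sublinear q' \<Longrightarrow> (\<And>x. q' x \<le> q x) \<Longrightarrow> q' = q"
proof -
  define A where "A = {q. sublinear q \<and> q \<le> p}"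
  have "\<exists>m\<in>A. \<forall>a\<in>A. a \<le> m \<longrightarrow> a = m"
  proof (rule predicate_Zorn)
    show "partial_order_on A (relation_of (\<lambda>a b. b \<le> a) A)"
      by (rule partial_order_on_relation_ofI) auto
    fix C assume C: "C \<in> Chains (relation_of (\<lambda>a b. b \<le> a) A)"
    then have CA: "C \<subseteq> A" and tot: "\<And>a b. a \<in> C \<Longrightarrow> b \<in> C \<Longrightarrow> a \<le> b \<or> b \<le> a"
      unfolding Chains_def relation_of_def by auto
    show "\<exists>u\<in>A. \<forall>a\<in>C. u \<le> a"
    proof (cases "C = {}")
      case True
      then show ?thesis using p by (auto simp: A_def)
    next
      case False
      define u where "u = (\<lambda>x. INF q\<in>C. q x)"
      have sub: "sublinear q" and qp: "q x \<le> p x" if "q \<in> C" for q x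
        using that CA by (auto simp: A_def le_fun_def)
      have "bdd_below ((\<lambda>q. q x) ` C)" for x
      proof (intro bdd_belowI[of _ "- p (- x)"])
        fix y assume "y \<in> (\<lambda>q. q x) ` C"
        then obtain q where "q \<in> C" "y = q x" by blast
        then show "- p (- x) \<le> y"
          using sublinear_minus_ge[OF sub, of q x] qp[of q "- x"] by simp
      qed
      then have le: "u x \<le> q x" if "q \<in> C" for q x
        unfolding u_def using that by (intro cINF_lower)
      have ge: "m \<le> u x" if "\<And>q. q \<in> C \<Longrightarrow> m \<le> q x" for m x
        unfolding u_def using that False by (intro cINF_greatest)
      have "u (x + y) \<le> u x + u y" for x y
      proof -
        have "u (x + y) \<le> q x + q' y" if "q \<in> C" "q' \<in> C" for q q'
        proof -
          \<comment> \<open>Subadditivity of the infimum rests on the chain property: the smaller of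
            \<open>q\<close> and \<open>q'\<close> can replace both.\<close>
          obtain k where k: "k \<in> C" "k \<le> q" "k \<le> q'"
            using tot[OF \<open>q \<in> C\<close> \<open>q' \<in> C\<close>] \<open>q \<in> C\<close> \<open>q' \<in> C\<close> by (meson order_refl)
          have "u (x + y) \<le> k x + k y"
            using le[OF k(1), of "x + y"] sublinear_add[OF sub[OF k(1)], of x y] by simp
          also have "\<dots> \<le> q x + q' y"
            using k by (intro add_mono) (auto simp: le_fun_def)
          finally show ?thesis .
        qed
        then have "u (x + y) - q' y \<le> u x" if "q' \<in> C" for q'
          using that by (intro ge) (simp add: algebra_simps)
        then have "u (x + y) - u x \<le> u y"
          by (intro ge) (simp add: algebra_simps)
        then show ?thesis by simp
      qed
      moreover have "u (c *\<^sub>R x) \<le> c * u x" if "c \<ge> 0" for c x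
      proof (cases "c = 0")
        case True
        obtain q where q: "q \<in> C" using False by blast
        then show ?thesis using le[OF q, of 0] sublinear_zero[OF sub[OF q]] True by simp
      next
        case False
        with that have c: "c > 0" by simp
        have "u (c *\<^sub>R x) / c \<le> u x"
        proof (rule ge)
          fix q assume q: "q \<in> C"
          then show "u (c *\<^sub>R x) / c \<le> q x"
            using le[OF q, of "c *\<^sub>R x"] sublinear_scaleR[OF sub[OF q] that, of x] c
            by (simp add: field_simps)
        qed
        then show ?thesis using c by (simp add: field_simps)
      qed
      ultimately have "sublinear u" by (simp add: sublinear_def)
      moreover have "u \<le> p"
      proof (rule le_funI)
        fix x
        obtain q where "q \<in> C" using False by blast
        then show "u x \<le> p x" using le qp order_trans by blast
      qed
      ultimately show ?thesis using le by (auto simp: A_def le_fun_def)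
    qed
  qed
  then obtain q where q: "q \<in> A" "\<And>a. a \<in> A \<Longrightarrow> a \<le> q \<Longrightarrow> a = q" by blast
  show ?thesis
  proof (rule that)
    show "sublinear q" "q x \<le> p x" for x using q(1) by (auto simp: A_def le_fun_def)
    fix q' assume q': "sublinear q'" "\<And>x. q' x \<le> q x"
    then have "q' \<le> q" by (simp add: le_fun_def)
    moreover from this have "q' \<in> A" using q(1) q'(1) by (auto simp: A_def)
    ultimately show "q' = q" by (intro q(2))
  qed
qed

text \<open>Shifting a minimal \<open>q\<close> along \<open>y\<close> cannot make it smaller, so
  \<open>q x \<le> q (x + y) - q y\<close>. This is the converse of subadditivity, and additivity
  extends homogeneity to negative scalars.\<close>

lemma exists_linear_le_sublinear:
  fixes p :: "'a::real_vector \<Rightarrow> real"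
  assumes "sublinear p"
  obtains f where "linear f" "\<And>x. f x \<le> p x"
proof -
  obtain q where q: "sublinear q" "\<And>x. q x \<le> p x"
    and min: "\<And>q'. sublinear q' \<Longrightarrow> (\<And>x. q' x \<le> q x) \<Longrightarrow> q' = q"
    using exists_minimal_sublinear[OF assms] by blast
  have add: "q (x + y) = q x + q y" for x y
  proof -
    obtain q' where "sublinear q'" "\<And>x. q' x \<le> q x" and le: "\<And>x. q' x \<le> q (x + y) - q y"
      using sublinear_shift[OF q(1)] by metis
    then have "q' = q" using min by blast
    then show ?thesis using le[of x] sublinear_add[OF q(1), of x y] by simp
  qed
  have minus: "q (- x) = - q x" for x
    using add[of x "- x"] sublinear_zero[OF q(1)] by simp
  have "q (c *\<^sub>R x) = c * q x" for c x
  proof (cases "c \<ge> 0")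
    case True
    then show ?thesis by (rule sublinear_scaleR[OF q(1)])
  next
    case False
    then show ?thesis
      using sublinear_scaleR[OF q(1), of "- c" x] minus[of "c *\<^sub>R x"] by simp
  qed
  then have "linear q" by (intro linearI) (auto simp: add)
  then show ?thesis using q(2) that by blast
qed

text \<open>No functional is extended from the line through \<open>x\<close>. Instead the norm is
  shifted along \<open>x\<close> to some \<open>p\<close> with
  \<open>p (- x) \<le> - norm x\<close>, so that every linear functional below \<open>p\<close> is
  at least \<open>norm x\<close> at \<open>x\<close>.\<close>

lemma exists_norming_functional:
  fixes x :: "'a::real_normed_vector"
  obtains f :: "'a \<Rightarrow>\<^sub>L real" where "norm f \<le> 1" "blinfun_apply f x = norm x"
proof -
  have "sublinear (norm :: 'a \<Rightarrow> real)"
    by (simp add: sublinear_def norm_triangle_ineq)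
  then obtain p where p: "sublinear p" "\<And>y. p y \<le> norm y" "\<And>y. p y \<le> norm (y + x) - norm x"
    using sublinear_shift by metis
  then obtain f where f: "linear f" "\<And>y. f y \<le> p y"
    using exists_linear_le_sublinear by blast
  interpret linear f by (rule f(1))
  have le: "f y \<le> norm y" for y using f(2) p(2) order_trans by blast
  have bound: "\<bar>f y\<bar> \<le> norm y" for y
    using le[of y] le[of "- y"] by (simp add: neg abs_le_iff)
  have "bounded_linear f"
    using bound by (intro bounded_linear_intro[where K = 1]) (auto simp: add scale)
  then have app: "blinfun_apply (Blinfun f) = f" by (rule bounded_linear_Blinfun_apply)
  have "norm (Blinfun f) \<le> 1"
    using bound by (intro norm_blinfun_bound) (auto simp: app)
  moreover have "f x = norm x"
    using f(2)[of "- x"] p(3)[of "- x"] le[of x] by (simp add: neg)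
  ultimately show ?thesis using that app by metis
qed

text \<open>A real norming functional \<open>u\<close> is the real part of the complex-linear
  functional sending \<open>y\<close> to \<open>u y - i * u (i y)\<close>.\<close>

lemma exists_norming_clinear_functional:
  fixes x :: "'a::complex_banach"
  obtains f :: "'a \<Rightarrow>\<^sub>L complex"
  where "f \<in> bounded_clinear_ops" "norm f \<le> 1" "blinfun_apply f x = norm x"
proof -
  obtain u :: "'a \<Rightarrow>\<^sub>L real" where u: "norm u \<le> 1" "blinfun_apply u x = norm x"
    by (rule exists_norming_functional)
  define f where "f = (\<lambda>y. Complex (u y) (- u (\<i> *\<^sub>C y)))"
  have u_le: "\<bar>u y\<bar> \<le> norm y" for y
    using norm_blinfun[of u y] mult_right_mono[OF u(1), of "norm y"] by simp
  have decomp: "z *\<^sub>C y = Re z *\<^sub>R y + Im z *\<^sub>R \<i> *\<^sub>C y" for z and y :: 'a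
  proof -
    have "z *\<^sub>C y = (complex_of_real (Re z) + complex_of_real (Im z) * \<i>) *\<^sub>C y"
      by (subst complex_eq[of z]) (simp add: mult.commute)
    then show ?thesis by (simp only: scaleC_add_left scaleC_scaleC[symmetric] scaleR_scaleC)
  qed
  have ii: "\<i> *\<^sub>C \<i> *\<^sub>C y = - y" for y :: 'a
    using scaleR_scaleC[of "-1" y] by (simp add: scaleC_scaleC)
  have add: "f (y + z) = f y + f z" for y z
    by (simp add: f_def scaleC_add_right blinfun.add_right complex_eq_iff)
  have scaleC: "f (z *\<^sub>C y) = z * f y" for z y
  proof -
    have "\<i> *\<^sub>C z *\<^sub>C y = Re z *\<^sub>R \<i> *\<^sub>C y - Im z *\<^sub>R y"
      using decomp[of z "\<i> *\<^sub>C y"] ii[of y] by (simp add: scaleC_scaleC mult.commute)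
    then show ?thesis
      by (simp add: f_def complex_eq_iff decomp[of z y] blinfun.bilinear_simps)
  qed
  have bound: "norm (f y) \<le> norm y" for y
  proof (cases "f y = 0")
    case False
    \<comment> \<open>This unimodular factor rotates \<open>f y\<close> onto its modulus, so the
      bound on the real part bounds the modulus.\<close>
    define w where "w = cnj (f y) / norm (f y)"
    have "w * f y = norm (f y)"
      using False complex_norm_square[of "f y"] by (simp add: w_def field_simps power2_eq_square)
    then have "norm (f y) = Re (f (w *\<^sub>C y))" by (simp add: scaleC)
    also have "\<dots> \<le> norm (w *\<^sub>C y)" using u_le[of "w *\<^sub>C y"] by (simp add: f_def)
    also have "\<dots> = norm y" using False by (simp add: norm_scaleC w_def norm_divide)
    finally show ?thesis .
  qed simp
  have "bounded_linear f"
    using bound by (intro bounded_linear_intro[where K = 1])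
      (auto simp: add scaleR_scaleC scaleC scaleC_complex_def)
  then have app: "blinfun_apply (Blinfun f) = f" by (rule bounded_linear_Blinfun_apply)
  have "Re (f x) = norm x" using u(2) by (simp add: f_def)
  \<comment> \<open>The real part already exhausts the bound \<open>norm x\<close> on the
    modulus.\<close>
  moreover have "Im (f x) = 0"
    using bound[of x] \<open>Re (f x) = norm x\<close> cmod_power2[of "f x"]
      power_mono[OF bound[of x], of 2] by simp
  ultimately have "f x = norm x" by (simp add: complex_eq_iff)
  moreover have "Blinfun f \<in> bounded_clinear_ops"
    by (simp add: bounded_clinear_ops_def app scaleC scaleC_complex_def)
  moreover have "norm (Blinfun f) \<le> 1"
    using bound by (intro norm_blinfun_bound) (auto simp: app)
  ultimately show ?thesis using that app by metis
qed

section \<open>Transfer of the ball-covering property\<close>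

text \<open>Each ball of the cover of \<open>V\<close> that contains some \<open>J w\<close> with
  \<open>w\<close> in \<open>W\<close> is traded for one ball of \<open>W\<close> containing all
  such \<open>w\<close>. One new ball per old ball keeps the family countable.\<close>

lemma has_BCP_transfer:
  assumes BCP: "has_BCP V"
    and J: "\<And>w. w \<in> W \<Longrightarrow> norm w = 1 \<Longrightarrow> J w \<in> V \<and> norm (J w) = 1"
    and ball: "\<And>T r w. T \<in> V \<Longrightarrow> 0 < r \<Longrightarrow> r < norm T \<Longrightarrow> w \<in> W \<Longrightarrow> norm (J w - T) \<le> r \<Longrightarrow>
      \<exists>c \<rho>. c \<in> W \<and> 0 < \<rho> \<and> \<rho> < norm c \<and> (\<forall>w\<in>W. norm (J w - T) \<le> r \<longrightarrow> norm (w - c) \<le> \<rho>)"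
  shows "has_BCP W"
proof -
  obtain B where B: "countable B" "B \<subseteq> V \<times> {0<..}" "\<forall>(c, r)\<in>B. 0 \<notin> cball c r"
    and cov: "V \<inter> sphere 0 1 \<subseteq> (\<Union>(c, r)\<in>B. cball c r)"
    using BCP unfolding has_BCP_def by blast
  define good where "good = (\<lambda>(T, r) (c, \<rho>). c \<in> W \<and> 0 < \<rho> \<and> \<rho> < norm c \<and>
    (\<forall>w\<in>W. norm (J w - T) \<le> r \<longrightarrow> norm (w - c) \<le> \<rho>))"
  \<comment> \<open>By \<open>ball\<close>, a discarded pair contains no \<open>J w\<close> with
    \<open>w\<close> in \<open>W\<close>, so covering is unaffected.\<close>
  define B' where "B' = {b \<in> B. \<exists>b'. good b b'}"
  define F where "F = (\<lambda>b. SOME b'. good b b')"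
  have F: "good b (F b)" if "b \<in> B'" for b
    using that unfolding B'_def F_def by (auto intro: someI_ex)
  have "countable (F ` B')" using B(1) by (simp add: B'_def)
  moreover have "F ` B' \<subseteq> W \<times> {0<..}" "\<forall>(c, r)\<in>F ` B'. 0 \<notin> cball c r"
    using F by (fastforce simp: good_def)+
  moreover have "W \<inter> sphere 0 1 \<subseteq> (\<Union>(c, r)\<in>F ` B'. cball c r)"
  proof
    fix w assume "w \<in> W \<inter> sphere 0 1"
    then have w: "w \<in> W" "norm w = 1" by auto
    then have "J w \<in> V \<inter> sphere 0 1" using J by simp
    then obtain T r where Tr: "(T, r) \<in> B" "J w \<in> cball T r" using cov by blast
    then have close: "norm (J w - T) \<le> r" by (simp add: dist_norm norm_minus_commute)
    have "T \<in> V" "0 < r" "r < norm T" using B Tr(1) by fastforce+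
    then have "\<exists>b'. good (T, r) b'" using ball[OF _ _ _ w(1) close] by (simp add: good_def)
    then have mem: "(T, r) \<in> B'" using Tr(1) by (simp add: B'_def)
    obtain c \<rho> where cr: "F (T, r) = (c, \<rho>)" by fastforce
    then have "w \<in> cball c \<rho>"
      using F[OF mem] w close by (auto simp: good_def dist_norm norm_minus_commute)
    then show "w \<in> (\<Union>(c, r)\<in>F ` B'. cball c r)" using mem cr by force
  qed
  ultimately show ?thesis unfolding has_BCP_def by blast
qed

section \<open>Scalar multiplication over a real normed field\<close>

locale scalar_action =
  fixes s :: "'k::real_normed_field \<Rightarrow> 'a::real_normed_vector \<Rightarrow> 'a"
  assumes add_right: "s z (x + y) = s z x + s z y"
    and add_left: "s (z + w) x = s z x + s w x"
    and action: "s z (s w x) = s (z * w) x"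
    and of_real: "s (of_real r) x = r *\<^sub>R x"
    and norm_action: "norm (s z x) = norm z * norm x"
begin

lemma one: "s 1 x = x"
  using of_real[of 1 x] by simp

lemma bilinear: "bounded_bilinear s"
proof
  show "s (r *\<^sub>R z) x = r *\<^sub>R s z x" "s z (r *\<^sub>R x) = r *\<^sub>R s z x" for r z x
    by (simp_all add: scaleR_conv_of_real action mult.commute flip: of_real)
  show "\<exists>K. \<forall>z x. norm (s z x) \<le> norm z * norm x * K"
    by (intro exI[of _ 1]) (simp add: norm_action)
qed (simp_all add: add_left add_right)

text \<open>Turns a bound on the distance from a multiple of \<open>x\<close> to \<open>y\<close>
  into a ball for \<open>x\<close> itself, centred at \<open>y\<close> divided by the
  scalar.\<close>

lemma norm_diff_inverse:
  assumes "a \<noteq> 0"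
  shows "norm (x - s (inverse a) y) = norm (s a x - y) / norm a"
proof -
  interpret bounded_bilinear s by (rule bilinear)
  have "x - s (inverse a) y = s (inverse a) (s a x - y)"
    using assms by (simp add: diff_right action one)
  then show ?thesis by (simp only: norm_action norm_inverse divide_inverse mult.commute)
qed

end

text \<open>Treats both scalar fields at once: all bounded operators for real scaling, the
  complex-linear ones for complex scaling, and the dual when \<open>t\<close> is the multiplication
  of the field.\<close>

definition commuting_ops ::
    "('k \<Rightarrow> 'a \<Rightarrow> 'a) \<Rightarrow> ('k \<Rightarrow> 'b \<Rightarrow> 'b) \<Rightarrow> ('a::real_normed_vector \<Rightarrow>\<^sub>L 'b::real_normed_vector) set"
  where "commuting_ops s t = {T. \<forall>z x. blinfun_apply T (s z x) = t z (blinfun_apply T x)}"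

lemma scalar_action_mult: "scalar_action ((*) :: 'k::real_normed_field \<Rightarrow> 'k \<Rightarrow> 'k)"
  by standard (simp_all add: algebra_simps norm_mult scaleR_conv_of_real)

text \<open>Otherwise \<open>r\<close> would bound the operator norm. Thus a ball missing the zero
  operator is witnessed at a single vector.\<close>

lemma blinfun_exceeds_radius:
  fixes T :: "'a::real_normed_vector \<Rightarrow>\<^sub>L 'b::real_normed_vector"
  assumes "0 < r" "r < norm T"
  obtains x where "x \<noteq> 0" "r * norm x < norm (blinfun_apply T x)"
proof -
  obtain x where x: "r * norm x < norm (blinfun_apply T x)"
    using norm_blinfun_bound[of r T] assms by (meson less_imp_le not_less)
  then have "x \<noteq> 0" by auto
  with x show ?thesis using that by blast
qed

locale normed_action = scalar_action s
  for s :: "'k::real_normed_field \<Rightarrow> 'a::real_normed_vector \<Rightarrow> 'a" +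
  assumes norming: "\<exists>f \<in> commuting_ops s (*). norm f \<le> 1 \<and> norm (blinfun_apply f x) = norm x"

text \<open>Both spaces are nonzero: if one is zero, the operator space has an empty unit sphere and
  hence the BCP, which says nothing about the other space.\<close>

locale operator_BCP = X: normed_action s + Y: normed_action t
  for s :: "'k::real_normed_field \<Rightarrow> 'a::real_normed_vector \<Rightarrow> 'a"
    and t :: "'k \<Rightarrow> 'b::real_normed_vector \<Rightarrow> 'b" +
  assumes nontrivial: "(UNIV :: 'a set) \<noteq> {0}" "(UNIV :: 'b set) \<noteq> {0}"
    and BCP: "has_BCP (commuting_ops s t)"
begin

section \<open>Rank-one operators and the two embeddings\<close>

definition rank1 :: "('a \<Rightarrow>\<^sub>L 'k) \<Rightarrow> 'b \<Rightarrow> ('a \<Rightarrow>\<^sub>L 'b)"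
  where "rank1 f y = Blinfun (\<lambda>x. t (blinfun_apply f x) y)"

lemma rank1_apply: "blinfun_apply (rank1 f y) x = t (blinfun_apply f x) y"
proof -
  interpret t: bounded_bilinear t by (rule Y.bilinear)
  have "bounded_linear (\<lambda>x. t (blinfun_apply f x) y)"
    by (rule bounded_linear_compose[OF t.bounded_linear_left blinfun.bounded_linear_right])
  then show ?thesis unfolding rank1_def by (simp add: bounded_linear_Blinfun_apply)
qed

lemma norm_rank1: "norm (rank1 f y) = norm f * norm y"
proof (cases "y = 0")
  case True
  interpret t: bounded_bilinear t by (rule Y.bilinear)
  have "rank1 f y = 0" using True by (intro blinfun_eqI) (simp add: rank1_apply t.zero_right)
  then show ?thesis using True by simp
next
  case False
  have "norm (rank1 f y) \<le> norm f * norm y"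
  proof (rule norm_blinfun_bound)
    show "norm (blinfun_apply (rank1 f y) x) \<le> norm f * norm y * norm x" for x
      using mult_right_mono[OF norm_blinfun[of f x], of "norm y"]
      by (simp add: rank1_apply Y.norm_action ac_simps)
  qed simp
  moreover have "norm f \<le> norm (rank1 f y) / norm y"
  proof (rule norm_blinfun_bound)
    show "norm (blinfun_apply f x) \<le> norm (rank1 f y) / norm y * norm x" for x
      using norm_blinfun[of "rank1 f y" x] False
      by (simp add: rank1_apply Y.norm_action field_simps)
  qed simp
  ultimately show ?thesis using False by (simp add: field_simps)
qed

lemma rank1_commuting: "f \<in> commuting_ops s (*) \<Longrightarrow> rank1 f y \<in> commuting_ops s t"
  by (simp add: commuting_ops_def rank1_apply Y.action)

lemma near_rank1_at:
  assumes "norm (rank1 f y - T) \<le> r"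
  shows "norm (t (blinfun_apply f x) y - blinfun_apply T x) \<le> r * norm x"
  using norm_blinfun[of "rank1 f y - T" x] mult_right_mono[OF assms, of "norm x"]
  by (simp add: blinfun.diff_left rank1_apply)

text \<open>For \<open>f\<close> of norm one, \<open>rank1 f\<close> embeds the codomain
  isometrically into the operators.\<close>

theorem BCP_codomain: "has_BCP (UNIV :: 'b set)"
proof -
  interpret t: bounded_bilinear t by (rule Y.bilinear)
  obtain x0 :: 'a where x0: "x0 \<noteq> 0" using nontrivial(1) by auto
  obtain f where f: "f \<in> commuting_ops s (*)" "norm f \<le> 1" "norm (blinfun_apply f x0) = norm x0"
    using X.norming by blast
  have nf: "norm f = 1"
    using norm_blinfun[of f x0] f x0 by simp
  show ?thesis
  proof (rule has_BCP_transfer[OF BCP, where J = "rank1 f"])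
    show "rank1 f w \<in> commuting_ops s t \<and> norm (rank1 f w) = 1" if "norm w = 1" for w
      using that f nf by (simp add: rank1_commuting norm_rank1)
    fix T r w assume r: "0 < r" "r < norm T" and w: "norm (rank1 f w - T) \<le> r"
    obtain x where x: "x \<noteq> 0" "r * norm x < norm (blinfun_apply T x)"
      using blinfun_exceeds_radius[OF r] by blast
    let ?a = "blinfun_apply f x"
    \<comment> \<open>If \<open>f x = 0\<close>, nearness at \<open>x\<close> would give
      \<open>norm (T x) \<le> r * norm x\<close>. The vector \<open>x\<close> depends only on
      \<open>T\<close> and \<open>r\<close>, so the new ball serves every \<open>w\<close> at
      once.\<close>
    have a: "?a \<noteq> 0"
      using near_rank1_at[OF w, of x] x(2) by (auto simp: t.zero_left)
    show "\<exists>c \<rho>. c \<in> UNIV \<and> 0 < \<rho> \<and> \<rho> < norm c \<and>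
        (\<forall>w\<in>UNIV. norm (rank1 f w - T) \<le> r \<longrightarrow> norm (w - c) \<le> \<rho>)"
    proof (intro exI conjI ballI impI)
      show "0 < r * norm x / norm ?a" using r x a by simp
      show "r * norm x / norm ?a < norm (t (inverse ?a) (blinfun_apply T x))"
        using divide_strict_right_mono[OF x(2), of "norm ?a"] a
        by (simp add: Y.norm_action norm_inverse divide_inverse mult.commute)
      show "norm (w - t (inverse ?a) (blinfun_apply T x)) \<le> r * norm x / norm ?a"
        if "norm (rank1 f w - T) \<le> r" for w
        using near_rank1_at[OF that, of x] a
        by (simp add: Y.norm_diff_inverse divide_right_mono)
    qed simp
  qed
qed

text \<open>A unit vector \<open>y0\<close> embeds the dual isometrically. The vector
  \<open>x\<close> only keeps the new ball away from the origin; the distance estimate is made at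
  every vector \<open>u\<close>.\<close>

theorem BCP_dual: "has_BCP (commuting_ops s ((*) :: 'k \<Rightarrow> 'k \<Rightarrow> 'k))"
proof -
  interpret t: bounded_bilinear t by (rule Y.bilinear)
  interpret m: scalar_action "(*) :: 'k \<Rightarrow> 'k \<Rightarrow> 'k" by (rule scalar_action_mult)
  obtain y1 :: 'b where "y1 \<noteq> 0" using nontrivial(2) by auto
  then obtain y0 :: 'b where y0: "norm y0 = 1" using norm_sgn[of y1] by auto
  show ?thesis
  proof (rule has_BCP_transfer[OF BCP, where J = "\<lambda>f. rank1 f y0"])
    show "rank1 f y0 \<in> commuting_ops s t \<and> norm (rank1 f y0) = 1"
      if "f \<in> commuting_ops s (*)" "norm f = 1" for f
      using that y0 by (simp add: rank1_commuting norm_rank1)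
    fix T r w
    assume T: "T \<in> commuting_ops s t" and r: "0 < r" "r < norm T"
      and w: "norm (rank1 w y0 - T) \<le> r"
    obtain x where x: "x \<noteq> 0" "r * norm x < norm (blinfun_apply T x)"
      using blinfun_exceeds_radius[OF r] by blast
    obtain g where g: "g \<in> commuting_ops t (*)" "norm g \<le> 1"
      "norm (blinfun_apply g (blinfun_apply T x)) = norm (blinfun_apply T x)"
      using Y.norming by blast
    let ?a = "blinfun_apply g y0"
    \<comment> \<open>Applying \<open>g\<close>, of norm at most one, turns nearness of operators
      into nearness of functionals.\<close>
    have near: "norm (?a * blinfun_apply f u - blinfun_apply g (blinfun_apply T u)) \<le> r * norm u"
      if "norm (rank1 f y0 - T) \<le> r" for f u
    proof -
      have "?a * blinfun_apply f u - blinfun_apply g (blinfun_apply T u) =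
          blinfun_apply g (t (blinfun_apply f u) y0 - blinfun_apply T u)"
        using g(1) by (simp add: commuting_ops_def blinfun.diff_right mult.commute)
      also have "norm \<dots> \<le> norm (t (blinfun_apply f u) y0 - blinfun_apply T u)"
        using norm_blinfun[of g] mult_right_mono[OF g(2) norm_ge_zero] by (metis mult_1 order_trans)
      also have "\<dots> \<le> r * norm u" by (rule near_rank1_at[OF that])
      finally show ?thesis .
    qed
    have a: "?a \<noteq> 0" using near[OF w, of x] x(2) g(3) by auto
    define c where "c = blinfun_mult_right (inverse ?a) o\<^sub>L g o\<^sub>L T"
    have c: "blinfun_apply c u = inverse ?a * blinfun_apply g (blinfun_apply T u)" for u
      by (simp add: c_def)
    show "\<exists>c \<rho>. c \<in> commuting_ops s (*) \<and> 0 < \<rho> \<and> \<rho> < norm c \<and>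
        (\<forall>w\<in>commuting_ops s (*). norm (rank1 w y0 - T) \<le> r \<longrightarrow> norm (w - c) \<le> \<rho>)"
    proof (intro exI conjI ballI impI)
      show "c \<in> commuting_ops s (*)" using T g(1) by (simp add: commuting_ops_def c)
      show "0 < r / norm ?a" using r a by simp
      \<comment> \<open>Since \<open>g\<close> norms \<open>T x\<close>, passing from
        \<open>T\<close> to \<open>c\<close> loses only the factor \<open>norm ?a\<close>, by which
        the radius is divided too.\<close>
      have "r / norm ?a * norm x < norm (blinfun_apply c x)"
        using divide_strict_right_mono[OF x(2), of "norm ?a"] a g(3)
        by (simp add: c norm_mult norm_inverse divide_inverse ac_simps)
      also have "\<dots> \<le> norm c * norm x" by (rule norm_blinfun)
      finally show "r / norm ?a < norm c"
        by (rule mult_right_less_imp_less) simp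
      fix f assume f: "norm (rank1 f y0 - T) \<le> r"
      show "norm (f - c) \<le> r / norm ?a"
      proof (rule norm_blinfun_bound)
        show "norm (blinfun_apply (f - c) u) \<le> r / norm ?a * norm u" for u
          using near[OF f, of u] m.norm_diff_inverse[OF a] a
          by (simp add: blinfun.diff_left c divide_right_mono)
      qed (use r in simp)
    qed
  qed
qed

end

section \<open>The real and complex cases\<close>

lemma commuting_ops_scaleR: "commuting_ops (*\<^sub>R) (*\<^sub>R) = UNIV"
  by (simp add: commuting_ops_def blinfun.scaleR_right)

lemma commuting_ops_real: "commuting_ops (*\<^sub>R) ((*) :: real \<Rightarrow> real \<Rightarrow> real) = UNIV"
  by (simp add: commuting_ops_def blinfun.scaleR_right)

lemma commuting_ops_scaleC: "commuting_ops (*\<^sub>C) (*\<^sub>C) = bounded_clinear_ops"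
  by (simp add: commuting_ops_def bounded_clinear_ops_def)

lemma commuting_ops_complex:
  "commuting_ops (*\<^sub>C) ((*) :: complex \<Rightarrow> complex \<Rightarrow> complex) = bounded_clinear_ops"
  by (simp add: commuting_ops_def bounded_clinear_ops_def scaleC_complex_def)

lemma normed_action_scaleR: "normed_action ((*\<^sub>R) :: real \<Rightarrow> 'a \<Rightarrow> 'a::real_normed_vector)"
proof
  fix x :: 'a
  obtain f :: "'a \<Rightarrow>\<^sub>L real" where "norm f \<le> 1" "blinfun_apply f x = norm x"
    by (rule exists_norming_functional)
  then show "\<exists>f\<in>commuting_ops (*\<^sub>R) (*). norm f \<le> 1 \<and> norm (blinfun_apply f x) = norm x"
    by (auto simp: commuting_ops_real)
qed (simp_all add: algebra_simps)

lemma normed_action_scaleC: "normed_action ((*\<^sub>C) :: complex \<Rightarrow> 'a \<Rightarrow> 'a::complex_banach)"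
proof
  fix x :: 'a
  obtain f :: "'a \<Rightarrow>\<^sub>L complex"
    where "f \<in> bounded_clinear_ops" "norm f \<le> 1" "blinfun_apply f x = norm x"
    by (rule exists_norming_clinear_functional)
  then show "\<exists>f\<in>commuting_ops (*\<^sub>C) (*). norm f \<le> 1 \<and> norm (blinfun_apply f x) = norm x"
    by (auto simp: commuting_ops_complex)
qed (simp_all add: scaleC_add_left scaleC_add_right scaleC_scaleC scaleR_scaleC norm_scaleC)

theorem theorem3p2:
  shows "((UNIV :: 'a::banach set) \<noteq> {0} \<and> (UNIV :: 'b::banach set) \<noteq> {0} \<and>
           has_BCP (UNIV :: ('a \<Rightarrow>\<^sub>L 'b) set) \<longrightarrow>
           has_BCP (UNIV :: ('a \<Rightarrow>\<^sub>L real) set) \<and> has_BCP (UNIV :: 'b set)) \<and>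
         ((UNIV :: 'c::complex_banach set) \<noteq> {0} \<and> (UNIV :: 'd::complex_banach set) \<noteq> {0} \<and>
           has_BCP (bounded_clinear_ops :: ('c \<Rightarrow>\<^sub>L 'd) set) \<longrightarrow>
           has_BCP (bounded_clinear_ops :: ('c \<Rightarrow>\<^sub>L complex) set) \<and> has_BCP (UNIV :: 'd set))"
proof (intro conjI[of "_ \<longrightarrow> _" "_ \<longrightarrow> _"] impI; elim conjE)
  assume "(UNIV :: 'a set) \<noteq> {0}" "(UNIV :: 'b set) \<noteq> {0}"
    "has_BCP (UNIV :: ('a \<Rightarrow>\<^sub>L 'b) set)"
  then interpret operator_BCP "(*\<^sub>R) :: real \<Rightarrow> 'a \<Rightarrow> 'a" "(*\<^sub>R) :: real \<Rightarrow> 'b \<Rightarrow> 'b"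
    by (intro operator_BCP.intro operator_BCP_axioms.intro normed_action_scaleR)
      (simp_all add: commuting_ops_scaleR)
  show "has_BCP (UNIV :: ('a \<Rightarrow>\<^sub>L real) set) \<and> has_BCP (UNIV :: 'b set)"
    using BCP_dual BCP_codomain by (simp add: commuting_ops_real)
next
  assume "(UNIV :: 'c set) \<noteq> {0}" "(UNIV :: 'd set) \<noteq> {0}"
    "has_BCP (bounded_clinear_ops :: ('c \<Rightarrow>\<^sub>L 'd) set)"
  then interpret operator_BCP "(*\<^sub>C) :: complex \<Rightarrow> 'c \<Rightarrow> 'c" "(*\<^sub>C) :: complex \<Rightarrow> 'd \<Rightarrow> 'd"
    by (intro operator_BCP.intro operator_BCP_axioms.intro normed_action_scaleC)
      (simp_all add: commuting_ops_scaleC)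
  show "has_BCP (bounded_clinear_ops :: ('c \<Rightarrow>\<^sub>L complex) set) \<and> has_BCP (UNIV :: 'd set)"
    using BCP_dual BCP_codomain by (simp add: commuting_ops_complex)
qed

end
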